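(* For any OPS instance $\mathcal P_o=(P,R,g)$, every valid schedule for $\mathcal P_o$ has heat at least $G^*=\max_{v\in P}\sum_{e\in R:\,v\in e} g(e)$.
   Context: An OPS instance $(P,R,g)$ consists of a finite simple undirected graph $(P,R)$ with growth rates $g:R\to\mathbb R_{>0}$. A schedule $S:\mathbb N_0\to 2^R$ is valid if every $S(t)$ is a matching of $(P,R)$. The recurrence time $r_S(e)$ of $e\in R$ is the supremum of $d+1$ over all $d\in\mathbb N$ for which some $t\in\mathbb N_0$ satisfies $e\notin S(t)\cup\dots\cup S(t+d-1)$ (and $1$ if no such $d$ exists); the heat of $S$ is $h(S)=\max_{e\in R} g(e) r_S(e)$. *)

theory Defs
  imports "HOL-Library.Extended_Real"
begin

definition simple_graph :: "'a set \<Rightarrow> 'a set set \<Rightarrow> bool" where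
  "simple_graph P R \<longleftrightarrow> finite P \<and> (\<forall>e\<in>R. e \<subseteq> P \<and> card e = 2)"

definition ops_instance :: "'a set \<Rightarrow> 'a set set \<Rightarrow> ('a set \<Rightarrow> real) \<Rightarrow> bool" where
  "ops_instance P R g \<longleftrightarrow> simple_graph P R \<and> (\<forall>e\<in>R. 0 < g e)"

definition matching :: "'a set set \<Rightarrow> 'a set set \<Rightarrow> bool" where
  "matching R M \<longleftrightarrow> M \<subseteq> R \<and> pairwise disjnt M"

definition valid_schedule :: "'a set set \<Rightarrow> (nat \<Rightarrow> 'a set set) \<Rightarrow> bool" where
  "valid_schedule R S \<longleftrightarrow> (\<forall>t. matching R (S t))"

(* Lengths d \<ge> 1 of windows t, ..., t+d-1 in which e is never scheduled. *)
definition gap_lengths :: "(nat \<Rightarrow> 'a set set) \<Rightarrow> 'a set \<Rightarrow> nat set" where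
  "gap_lengths S e = {d. 1 \<le> d \<and> (\<exists>t. e \<notin> (\<Union>i\<in>{t..<t + d}. S i))}"

(* Infinite if the gaps of e are unbounded. *)
definition recurrence_time :: "(nat \<Rightarrow> 'a set set) \<Rightarrow> 'a set \<Rightarrow> enat" where
  "recurrence_time S e =
     (if gap_lengths S e = {} then 1 else (SUP d\<in>gap_lengths S e. enat (d + 1)))"

(* Maxima over the empty set, which Max leaves unspecified, are taken to be 0 here and below. *)
definition heat :: "'a set set \<Rightarrow> ('a set \<Rightarrow> real) \<Rightarrow> (nat \<Rightarrow> 'a set set) \<Rightarrow> ereal" where
  "heat R g S =
     (if R = {} then 0
      else Max ((\<lambda>e. ereal (g e) * ereal_of_enat (recurrence_time S e)) ` R))"

definition max_growth_sum :: "'a set \<Rightarrow> 'a set set \<Rightarrow> ('a set \<Rightarrow> real) \<Rightarrow> real" where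
  "max_growth_sum P R g =
     (if P = {} then 0 else Max ((\<lambda>v. \<Sum>e\<in>{e \<in> R. v \<in> e}. g e) ` P))"

end

theory Submission
  imports Defs
begin

text \<open>If \<open>e\<close> has finite recurrence time \<open>r e\<close>, every window of \<open>r e\<close> consecutive days contains \<open>e\<close>, so
  \<open>e\<close> has density at least \<open>1 / r e\<close>. The edges at a vertex \<open>v\<close> are never scheduled on the same day,
  hence \<open>\<Sum> 1 / r e \<le> 1\<close> over these edges. Combined with \<open>g e \<le> H / r e\<close> for the heat \<open>H\<close>, this yields
  \<open>\<Sum> g e \<le> H\<close>.\<close>

text \<open>The first \<open>n * r\<close> days split into \<open>n\<close> disjoint blocks of
  length \<open>r\<close>, and each block contributes a hit of its own.\<close>

lemma card_ge_if_windows_hit: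
  fixes Q :: "nat \<Rightarrow> bool"
  assumes "\<And>t. \<exists>i\<in>{t..<t + r}. Q i"
  shows "n \<le> card {i. i < n * r \<and> Q i}"
proof (induction n)
  case (Suc n)
  obtain i where i: "n * r \<le> i" "i < n * r + r" "Q i"
    using assms[of "n * r"] by auto
  have "Suc n \<le> card (insert i {i. i < n * r \<and> Q i})"
    using Suc i by (subst card_insert_disjoint) auto
  also have "\<dots> \<le> card {i. i < Suc n * r \<and> Q i}"
    using i by (intro card_mono) auto
  finally show ?case .
qed simp

text \<open>Double counting over a finite horizon: by \<open>excl\<close> each day serves at most
  one element of \<open>A\<close>, while each \<open>e\<close> uses up at least a
  \<open>1 / r e\<close> share of the days.\<close>

lemma sum_inverse_window_le_1:
  fixes S :: "nat \<Rightarrow> 'b set" and r :: "'b \<Rightarrow> nat"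
  assumes "finite A"
    and pos: "\<And>e. e \<in> A \<Longrightarrow> 0 < r e"
    and hit: "\<And>e t. e \<in> A \<Longrightarrow> \<exists>i\<in>{t..<t + r e}. e \<in> S i"
    and excl: "\<And>e e' i. e \<in> A \<Longrightarrow> e' \<in> A \<Longrightarrow> e \<in> S i \<Longrightarrow> e' \<in> S i \<Longrightarrow> e = e'"
  shows "(\<Sum>e\<in>A. 1 / real (r e)) \<le> 1"
proof -
  \<comment> \<open>A common multiple of all \<open>r e\<close>: the horizon splits exactly into
    windows of every \<open>e\<close>, so that neither rounding nor a limit is involved.\<close>
  define T where "T = prod r A"
  have "T > 0"
    unfolding T_def using pos by (simp add: prod_pos)
  define B where "B e = {i. i < T \<and> e \<in> S i}" for e
  have "real T / real (r e) \<le> card (B e)" if e: "e \<in> A" for e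
  proof -
    obtain n where n: "T = n * r e"
      using dvd_prodI[OF \<open>finite A\<close> e, of r] unfolding T_def
      by (metis dvd_def mult.commute)
    have "n \<le> card (B e)"
      unfolding B_def n by (rule card_ge_if_windows_hit) (rule hit[OF e])
    then show ?thesis
      using n pos[OF e] by simp
  qed
  then have "(\<Sum>e\<in>A. real T / real (r e)) \<le> (\<Sum>e\<in>A. real (card (B e)))"
    by (rule sum_mono)
  \<comment> \<open>By \<open>excl\<close> the sets \<open>B e\<close> are pairwise
    disjoint.\<close>
  also have "\<dots> = real (card (\<Union>e\<in>A. B e))"
    using \<open>finite A\<close> excl by (subst card_UN_disjoint) (auto simp: B_def)
  also have "\<dots> \<le> real T"
    using card_mono[of "{..<T}" "\<Union>e\<in>A. B e"] by (auto simp: B_def)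
  finally have "real T * (\<Sum>e\<in>A. 1 / real (r e)) \<le> real T"
    by (simp add: sum_distrib_left)
  with \<open>T > 0\<close> show ?thesis
    by simp
qed

lemma recurrence_time_pos: "1 \<le> recurrence_time S e"
proof (cases "gap_lengths S e = {}")
  case False
  then obtain d where d: "d \<in> gap_lengths S e"
    by blast
  have "1 \<le> enat (d + 1)"
    by (simp add: one_enat_def)
  also have "\<dots> \<le> recurrence_time S e"
    using d by (auto simp: recurrence_time_def intro: SUP_upper)
  finally show ?thesis .
qed (simp add: recurrence_time_def)

text \<open>A window of length \<open>r\<close> that misses \<open>e\<close> would be a gap of
  length \<open>r\<close> and push the supremum to at least \<open>r + 1\<close>.\<close>

lemma recurrence_time_window:
  assumes "recurrence_time S e = enat r"
  shows "\<exists>i\<in>{t..<t + r}. e \<in> S i"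
proof (rule ccontr)
  assume "\<not> ?thesis"
  \<comment> \<open>Only lengths from 1 on count as gaps, so \<open>r = 0\<close>, with its empty
    window, has to be excluded.\<close>
  moreover have "1 \<le> r"
    using recurrence_time_pos[of S e] assms by (simp add: one_enat_def)
  ultimately have gap: "r \<in> gap_lengths S e"
    unfolding gap_lengths_def by blast
  then have "enat (r + 1) \<le> recurrence_time S e"
    by (auto simp: recurrence_time_def intro: SUP_upper)
  with assms show False
    by simp
qed

lemma sum_growth_at_vertex_le_heat:
  assumes "finite R" "R \<noteq> {}" and gpos: "\<And>e. e \<in> R \<Longrightarrow> 0 < g e"
    and valid: "valid_schedule R S"
  shows "ereal (\<Sum>e\<in>{e \<in> R. v \<in> e}. g e) \<le> heat R g S"
proof -
  have le: "ereal (g e) * ereal_of_enat (recurrence_time S e) \<le> heat R g S" if "e \<in> R" for e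
    using that assms(1,2) by (auto simp: heat_def intro: Max_ge)
  have nonneg: "0 \<le> ereal (g e) * ereal_of_enat (recurrence_time S e)" if "e \<in> R" for e
    using gpos[OF that] by (simp add: less_imp_le)
  have heat_nonneg: "0 \<le> heat R g S"
    using \<open>R \<noteq> {}\<close> nonneg le order_trans by blast
  show ?thesis
  \<comment> \<open>Infinite heat makes the bound trivial, and \<open>heat_nonneg\<close> rules out
    negative infinity.\<close>
  proof (cases "heat R g S")
    case (real H)
    define r where "r e = the_enat (recurrence_time S e)" for e
    have r: "recurrence_time S e = enat (r e)" if "e \<in> R" for e
    proof (cases "recurrence_time S e")
      \<comment> \<open>As \<open>g e > 0\<close>, an infinite recurrence time would make the heat
        infinite.\<close>
      case infinity
      with le[OF that] gpos[OF that] real show ?thesis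
        by simp
    qed (simp add: r_def)
    have r_pos: "0 < r e" if "e \<in> R" for e
      using recurrence_time_pos[of S e] r[OF that] by (simp add: one_enat_def)
    have g_le: "g e \<le> H * (1 / real (r e))" if "e \<in> R" for e
      using le[OF that] r[OF that] r_pos[OF that] real by (simp add: field_simps)
    have "(\<Sum>e\<in>{e \<in> R. v \<in> e}. 1 / real (r e)) \<le> 1"
    proof (rule sum_inverse_window_le_1[where S = S])
      fix e e' i
      assume "e \<in> {e \<in> R. v \<in> e}" "e' \<in> {e \<in> R. v \<in> e}" "e \<in> S i" "e' \<in> S i"
      \<comment> \<open>Both edges contain \<open>v\<close>, so they are not disjoint; distinct
        members of a matching are.\<close>
      then show "e = e'"
        using valid unfolding valid_schedule_def matching_def pairwise_def disjnt_def by blast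
    qed (use assms(1) r_pos recurrence_time_window[OF r] in simp_all)
    then have "H * (\<Sum>e\<in>{e \<in> R. v \<in> e}. 1 / real (r e)) \<le> H"
      using heat_nonneg real mult_left_mono[of _ 1 H] by simp
    moreover have "(\<Sum>e\<in>{e \<in> R. v \<in> e}. g e) \<le> H * (\<Sum>e\<in>{e \<in> R. v \<in> e}. 1 / real (r e))"
      unfolding sum_distrib_left using g_le by (intro sum_mono) auto
    ultimately show ?thesis
      using real by simp
  qed (use heat_nonneg in auto)
qed

theorem theorem5:
  fixes P :: "'a set" and R :: "'a set set" and g :: "'a set \<Rightarrow> real"
    and S :: "nat \<Rightarrow> 'a set set"
  assumes "ops_instance P R g"
    and "valid_schedule R S"
  shows "ereal (max_growth_sum P R g) \<le> heat R g S"
proof -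
  from assms(1) have "finite P" and R: "\<And>e. e \<in> R \<Longrightarrow> e \<subseteq> P \<and> card e = 2"
    and gpos: "\<And>e. e \<in> R \<Longrightarrow> 0 < g e"
    by (auto simp: ops_instance_def simple_graph_def)
  have "finite R"
    using \<open>finite P\<close> R by (intro finite_subset[of R "Pow P"]) auto
  show ?thesis
  proof (cases "R = {}")
    case True
    \<comment> \<open>All vertex sums are empty, so the left side is 0 whether or not
      \<open>P\<close> is empty, and the heat is 0 by its default value.\<close>
    then show ?thesis
      by (simp add: max_growth_sum_def heat_def image_constant_conv)
  next
    case False
    \<comment> \<open>An edge supplies a vertex, so the maximum is a genuine one and is attained at
      some \<open>v\<close>.\<close>
    then have "P \<noteq> {}"
      using R by fastforce
    then have "max_growth_sum P R g \<in> (\<lambda>v. \<Sum>e\<in>{e \<in> R. v \<in> e}. g e) ` P"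
      unfolding max_growth_sum_def using \<open>finite P\<close> by (auto intro!: Max_in)
    then obtain v where "max_growth_sum P R g = (\<Sum>e\<in>{e \<in> R. v \<in> e}. g e)"
      by blast
    then show ?thesis
      using sum_growth_at_vertex_le_heat[OF \<open>finite R\<close> False gpos assms(2)] by simp
  qed
qed

end
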